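(* Taking each cover number, as well as the clique number $\omega$ and the chromatic number $\chi$, as functions acting on graphs, with equalities and inequalities between functions understood pointwise (that is, for every graph), the following holds: $$\left\lceil \frac{\log \chi}{\log \omega} \right\rceil = c_{\{\chi = \omega\}} \leq c_{\mathbf{PERF}} \leq c_{\mathbf{GSP}} \leq c_{\mathbf{coUNIP}} \leq c_{\mathbf{BIP}} = \left\lceil \log \chi \right\rceil.$$
   Context: Logarithms are to base 2. For a class of graphs $\mathcal{P}$, a covering of a graph $G$ by graphs of class $\mathcal{P}$ is an expression $E(G) = E(G_1) \cup \dots \cup E(G_k)$ of the edge set of $G$ as the union of the edge sets of graphs $G_1, \dots, G_k$ with $G_i \in \mathcal{P}$ for all $i \in \{1, \dots, k\}$. The cover number $c_{\mathcal{P}}(G)$ is the smallest $k$ such that $G$ admits a covering by $k$ graphs of class $\mathcal{P}$. A graph is perfect if it and all of its induced subgraphs $H$ satisfy $\chi(H) = \omega(H)$. A graph $G$ is unipolar if $V(G)$ is a disjoint union $V(A) \cup V(B)$ such that $A$ is a clique and $B$ is a disjoint union of cliques ($A$ and $B$ being the subgraphs of $G$ induced by the two parts). A graph is co-unipolar if its complement is unipolar, and generalized split (GSP) if it is unipolar or co-unipolar. $c_{\{\chi=\omega\}}$, $c_{\mathbf{PERF}}$, $c_{\mathbf{GSP}}$, $c_{\mathbf{coUNIP}}$, $c_{\mathbf{BIP}}$ denote the cover numbers by, respectively, the class $\{H \mid \chi(H) = \omega(H)\}$, perfect graphs, GSP graphs, co-unipolar graphs, and bipartite graphs. *)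

theory Defs
  imports Complex_Main "HOL-Library.Ramsey" "HOL-Library.Disjoint_Sets"
begin

record 'a sgraph =
  verts :: "'a set"
  edges :: "'a set set"

definition graph :: "'a sgraph \<Rightarrow> bool" where
  "graph G \<longleftrightarrow> finite (verts G) \<and> edges G \<subseteq> [verts G]\<^bsup>2\<^esup>"

definition induced :: "'a sgraph \<Rightarrow> 'a set \<Rightarrow> 'a sgraph" where
  "induced G S = \<lparr>verts = S, edges = {e \<in> edges G. e \<subseteq> S}\<rparr>"

definition complement :: "'a sgraph \<Rightarrow> 'a sgraph" where
  "complement G = \<lparr>verts = verts G, edges = [verts G]\<^bsup>2\<^esup> - edges G\<rparr>"

definition proper_colouring :: "'a sgraph \<Rightarrow> ('a \<Rightarrow> nat) \<Rightarrow> nat \<Rightarrow> bool" where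
  "proper_colouring G f k \<longleftrightarrow>
     f \<in> verts G \<rightarrow> {..<k} \<and> (\<forall>u v. {u, v} \<in> edges G \<longrightarrow> f u \<noteq> f v)"

definition chromatic_number :: "'a sgraph \<Rightarrow> nat" where
  "chromatic_number G = (LEAST k. \<exists>f. proper_colouring G f k)"

definition clique_number :: "'a sgraph \<Rightarrow> nat" where
  "clique_number G = Max {card K | K. K \<subseteq> verts G \<and> clique K (edges G)}"

definition complete_graph :: "'a sgraph \<Rightarrow> bool" where
  "complete_graph G \<longleftrightarrow> clique (verts G) (edges G)"

text \<open>The cliques of the union are the members of the partition \<open>P\<close>; there may be none of
  them, in which case \<open>G\<close> has no vertices.\<close>

definition disjoint_union_of_cliques :: "'a sgraph \<Rightarrow> bool" where
  "disjoint_union_of_cliques G \<longleftrightarrow>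
     (\<exists>P. partition_on (verts G) P \<and> edges G = (\<Union>C\<in>P. [C]\<^bsup>2\<^esup>))"

text \<open>Either part of a unipolar or bipartite graph may be empty.\<close>

definition unipolar :: "'a sgraph \<Rightarrow> bool" where
  "unipolar G \<longleftrightarrow>
     (\<exists>A B. verts G = A \<union> B \<and> A \<inter> B = {} \<and>
        complete_graph (induced G A) \<and> disjoint_union_of_cliques (induced G B))"

definition co_unipolar :: "'a sgraph \<Rightarrow> bool" where
  "co_unipolar G \<longleftrightarrow> unipolar (complement G)"

definition perfect :: "'a sgraph \<Rightarrow> bool" where
  "perfect G \<longleftrightarrow>
     (\<forall>S \<subseteq> verts G. chromatic_number (induced G S) = clique_number (induced G S))"

definition bipartite :: "'a sgraph \<Rightarrow> bool" where
  "bipartite G \<longleftrightarrow>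
     (\<exists>X Y. verts G = X \<union> Y \<and> X \<inter> Y = {} \<and> indep X (edges G) \<and> indep Y (edges G))"

definition CHI_EQ_OMEGA :: "'a sgraph set" where
  "CHI_EQ_OMEGA = {G. graph G \<and> chromatic_number G = clique_number G}"

definition PERF :: "'a sgraph set" where
  "PERF = {G. graph G \<and> perfect G}"

definition GSP :: "'a sgraph set" where
  "GSP = {G. graph G \<and> (unipolar G \<or> co_unipolar G)}"

definition coUNIP :: "'a sgraph set" where
  "coUNIP = {G. graph G \<and> co_unipolar G}"

definition BIP :: "'a sgraph set" where
  "BIP = {G. graph G \<and> bipartite G}"

definition covering :: "'a sgraph set \<Rightarrow> 'a sgraph \<Rightarrow> 'a sgraph list \<Rightarrow> bool" where
  "covering P G Gs \<longleftrightarrow> set Gs \<subseteq> P \<and> edges G = (\<Union>H\<in>set Gs. edges H)"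

text \<open>The number of covering graphs may be zero, so that an edgeless graph has cover number
  \<open>0\<close>. This is forced by \<open>\<lceil>log 2 1\<rceil> = 0\<close> for the cover number by bipartite graphs, and it agrees
  with the library value \<open>0 / 0 = 0\<close> of \<open>log 2 \<chi> / log 2 \<omega>\<close> for edgeless graphs.\<close>

definition cover_number :: "'a sgraph set \<Rightarrow> 'a sgraph \<Rightarrow> nat" where
  "cover_number P G = (LEAST k. \<exists>Gs. length Gs = k \<and> covering P G Gs)"

end

theory Submission
  imports Defs
begin

text \<open>
  The two outer equalities have a common source: coverings are the same thing as colourings by
  words. If \<open>k\<close> graphs cover \<open>G\<close> and each has a proper colouring with \<open>b\<close> colours, then the
  \<open>k\<close>-tuples of colours properly colour \<open>G\<close>, so \<open>\<chi>(G) \<le> b ^ k\<close>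
  (\<open>chromatic_number_le_power\<close>). Conversely, if \<open>\<chi>(G) \<le> b ^ k\<close>, the colours can be renamed to words
  of length \<open>k\<close> over \<open>b\<close> letters; the edges whose ends differ in the \<open>i\<close>-th letter form a
  \<open>b\<close>-colourable graph, the \<open>i\<close>-th slice, and the \<open>k\<close> slices cover \<open>G\<close>
  (\<open>edges_eq_Union_slices\<close>). Taking \<open>b = 2\<close>, a covering by \<open>k\<close> bipartite graphs exists iff
  \<open>\<chi>(G) \<le> 2 ^ k\<close>, and the least such \<open>k\<close> is \<open>\<lceil>log \<chi>(G)\<rceil>\<close>.

  For the class \<open>\<chi> = \<omega>\<close> one takes \<open>b = \<omega>(G)\<close>. A covering graph has \<open>\<chi> = \<omega> \<le> \<omega>(G)\<close>, which gives the
  lower bound. For the upper bound the slices must also have cliques of size \<open>\<omega>(G)\<close>. This is achieved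
  by choosing the words well: the vertices of a maximum clique receive the constant words, so that any
  two of them differ in every letter and the clique survives in every slice
  (\<open>chi_eq_omega_covering_iff\<close>).

  The inner inequalities come from the inclusions between the classes. The only substantial one is
  that generalized split graphs are perfect. As unipolar and co-unipolar graphs are closed
  under induced subgraphs, it suffices to prove \<open>\<chi> = \<omega>\<close> for both kinds, and this can be done separately,
  without the weak perfect graph theorem. For unipolar graphs, the central clique is coloured
  injectively and the colouring is extended to each of the other cliques by Hall's theorem, whose
  condition says exactly that certain cliques have at most \<open>\<omega>\<close> vertices. For co-unipolar graphs,
  the number \<open>m\<close> of parts of the complete multipartite part determines the number of colours up
  to one, and a transversal of the parts supplies the clique.
\<close>

section \<open>Systems of distinct representatives\<close>

text \<open>
  The proof of Halmos and Vaughan. Either some proper nonempty subfamily is tight, and then it and the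
  rest of the family, with the values of the tight part removed, both satisfy the
  condition again; or no such subfamily is tight, and then one value can be removed
  from all members of the family but one, which it represents.
\<close>

lemma hall_marriage:
  fixes S :: "'i \<Rightarrow> 'c set"
  assumes "finite I" "\<And>i. i \<in> I \<Longrightarrow> finite (S i)"
    and "\<And>J. J \<subseteq> I \<Longrightarrow> card J \<le> card (\<Union>i\<in>J. S i)"
  shows "\<exists>r. inj_on r I \<and> (\<forall>i\<in>I. r i \<in> S i)"
  using assms
proof (induction I arbitrary: S rule: finite_psubset_induct)
  case (psubset I)
  note fin = psubset.prems(1) and hall = psubset.prems(2)
  show ?case
  proof (cases "I = {}")
    case True
    then show ?thesis by auto
  next
    case False
    show ?thesis
    proof (cases "\<exists>J. J \<subset> I \<and> J \<noteq> {} \<and> card (\<Union>i\<in>J. S i) = card J")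
      case True
      then obtain J where J: "J \<subset> I" "J \<noteq> {}" and tight: "card (\<Union>i\<in>J. S i) = card J"
        by blast
      let ?U = "\<Union>i\<in>J. S i"
      have finJ: "finite J" using J psubset.hyps finite_subset by blast
      obtain r where r: "inj_on r J" "\<forall>i\<in>J. r i \<in> S i"
        using psubset.IH[OF J(1), of S] J(1) fin hall by (metis psubsetE subset_eq)
      have "\<exists>s. inj_on s (I - J) \<and> (\<forall>i\<in>I - J. s i \<in> S i - ?U)"
      proof (rule psubset.IH)
        show "I - J \<subset> I" using J by blast
        show "finite (S i - ?U)" if "i \<in> I - J" for i using that fin by auto
        show "card L \<le> card (\<Union>i\<in>L. S i - ?U)" if L: "L \<subseteq> I - J" for L
        proof -
          have finL: "finite L" using L psubset.hyps finite_subset by blast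
          have "card L + card J = card (L \<union> J)"
            using L finL finJ by (intro card_Un_disjoint[symmetric]) auto
          also have "\<dots> \<le> card (\<Union>i\<in>L \<union> J. S i)" using L J by (intro hall) auto
          also have "(\<Union>i\<in>L \<union> J. S i) = (\<Union>i\<in>L. S i - ?U) \<union> ?U" by auto
          also have "card \<dots> \<le> card (\<Union>i\<in>L. S i - ?U) + card ?U" by (rule card_Un_le)
          finally show ?thesis using tight by simp
        qed
      qed
      then obtain s where s: "inj_on s (I - J)" "\<forall>i\<in>I - J. s i \<in> S i - ?U" by blast
      let ?t = "\<lambda>i. if i \<in> J then r i else s i"
      have "r ` J \<subseteq> ?U" using r(2) by auto
      moreover have "?U \<inter> s ` (I - J) = {}" using s(2) by auto
      ultimately have "r ` J \<inter> s ` (I - J) = {}" by blast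
      then have "inj_on ?t (J \<union> (I - J))" using r(1) s(1) by (intro inj_on_disjoint_Un)
      moreover have "J \<union> (I - J) = I" using J by blast
      ultimately have "inj_on ?t I" by simp
      moreover have "\<forall>i\<in>I. ?t i \<in> S i" using r s by auto
      ultimately show ?thesis by blast
    next
      case slack: False
      obtain i where i: "i \<in> I" using False by blast
      have "card {i} \<le> card (S i)" using hall[of "{i}"] i by simp
      then obtain x where x: "x \<in> S i" by fastforce
      have "\<exists>s. inj_on s (I - {i}) \<and> (\<forall>j\<in>I - {i}. s j \<in> S j - {x})"
      proof (rule psubset.IH)
        show "I - {i} \<subset> I" using i by blast
        show "finite (S j - {x})" if "j \<in> I - {i}" for j using that fin by auto
        show "card L \<le> card (\<Union>j\<in>L. S j - {x})" if L: "L \<subseteq> I - {i}" for L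
        proof (cases "L = {}")
          case nonempty: False
          have "L \<subset> I" using L i by blast
          then have "card L < card (\<Union>j\<in>L. S j)"
            using hall[of L] slack nonempty by (metis le_neq_implies_less psubset_imp_subset)
          moreover have "(\<Union>j\<in>L. S j - {x}) = (\<Union>j\<in>L. S j) - {x}" by auto
          moreover have "card (\<Union>j\<in>L. S j) - 1 \<le> card ((\<Union>j\<in>L. S j) - {x})"
            by (simp add: card_Diff_singleton_if)
          ultimately show ?thesis by simp
        qed simp
      qed
      then obtain s where s: "inj_on s (I - {i})" "\<forall>j\<in>I - {i}. s j \<in> S j - {x}" by blast
      let ?t = "\<lambda>j. if j \<in> {i} then x else s j"
      have "x \<notin> s ` (I - {i})" using s(2) by blast
      then have "inj_on ?t ({i} \<union> (I - {i}))"
        using s(1) by (intro inj_on_disjoint_Un) auto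
      moreover have "{i} \<union> (I - {i}) = I" using i by blast
      ultimately have "inj_on ?t I" by simp
      moreover have "\<forall>j\<in>I. ?t j \<in> S j" using s x by auto
      ultimately show ?thesis by blast
    qed
  qed
qed

section \<open>Chromatic number and clique number\<close>

lemma graph_edge:
  assumes "graph G" "{u, v} \<in> edges G"
  shows "u \<in> verts G" "v \<in> verts G" "u \<noteq> v"
  using assms by (auto simp: graph_def nsets_def card_2_iff doubleton_eq_iff)

lemma graph_edgeE:
  assumes "graph G" "e \<in> edges G"
  obtains u v where "e = {u, v}" "u \<in> verts G" "v \<in> verts G" "u \<noteq> v"
  using assms by (auto simp: graph_def nsets_def card_2_iff)

lemma graph_induced: "graph G \<Longrightarrow> S \<subseteq> verts G \<Longrightarrow> graph (induced G S)"
  by (auto simp: graph_def induced_def nsets_def intro: finite_subset)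

lemma card_clique_le_clique_number:
  assumes "graph G" "K \<subseteq> verts G" "clique K (edges G)"
  shows "card K \<le> clique_number G"
  unfolding clique_number_def
proof (rule Max_ge)
  have "finite (card ` Pow (verts G))" using assms(1) by (simp add: graph_def)
  then show "finite {card K |K. K \<subseteq> verts G \<and> clique K (edges G)}"
    by (rule rev_finite_subset) auto
qed (use assms in auto)

lemma obtain_maximum_clique:
  assumes "graph G"
  obtains K where "K \<subseteq> verts G" "clique K (edges G)" "card K = clique_number G"
proof -
  let ?M = "{card K |K. K \<subseteq> verts G \<and> clique K (edges G)}"
  have "finite (card ` Pow (verts G))" using assms by (simp add: graph_def)
  then have "finite ?M" by (rule rev_finite_subset) auto
  moreover have "card {} \<in> ?M" by (force simp: clique_def)
  ultimately have "Max ?M \<in> ?M" by (intro Max_in) auto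
  then show ?thesis using that by (auto simp: clique_number_def)
qed

lemma chromatic_number_le:
  assumes "proper_colouring G f k"
  shows "chromatic_number G \<le> k"
  unfolding chromatic_number_def using assms by (intro Least_le) blast

text \<open>
  Colours from an arbitrary finite set: this admits words, options and truth values as colours.
\<close>

lemma chromatic_number_le_card:
  assumes "finite C" "\<And>v. v \<in> verts G \<Longrightarrow> f v \<in> C" "graph G"
    and "\<And>u v. {u, v} \<in> edges G \<Longrightarrow> f u \<noteq> f v"
  shows "chromatic_number G \<le> card C"
proof -
  obtain e where e: "bij_betw e C {..<card C}"
    using assms(1) ex_bij_betw_finite_nat by (metis atLeast0LessThan)
  have "proper_colouring G (e \<circ> f) (card C)"
    unfolding proper_colouring_def
    using e assms graph_edge[OF assms(3)]
    by (auto simp: bij_betw_def inj_on_def Pi_def) blast+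
  then show ?thesis by (rule chromatic_number_le)
qed

lemma obtain_optimal_colouring:
  assumes "graph G"
  obtains f where "proper_colouring G f (chromatic_number G)"
proof -
  obtain e where "bij_betw e (verts G) {..<card (verts G)}"
    using assms ex_bij_betw_finite_nat unfolding graph_def by (metis atLeast0LessThan)
  then have "proper_colouring G e (card (verts G))"
    using graph_edge[OF assms]
    by (auto simp: proper_colouring_def bij_betw_def inj_on_eq_iff)
  then have "\<exists>k f. proper_colouring G f k" by blast
  then have "\<exists>f. proper_colouring G f (chromatic_number G)"
    unfolding chromatic_number_def by (rule LeastI_ex)
  then show ?thesis using that by blast
qed

lemma inj_on_clique:
  assumes "proper_colouring G f k" "clique K (edges G)"
  shows "inj_on f K"
  using assms unfolding proper_colouring_def clique_def inj_on_def by metis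

lemma clique_number_le_chromatic_number:
  assumes "graph G"
  shows "clique_number G \<le> chromatic_number G"
proof -
  obtain K where K: "K \<subseteq> verts G" "clique K (edges G)" "card K = clique_number G"
    using obtain_maximum_clique[OF assms] .
  obtain f where f: "proper_colouring G f (chromatic_number G)"
    using obtain_optimal_colouring[OF assms] .
  have "f ` K \<subseteq> {..<chromatic_number G}" using f K by (auto simp: proper_colouring_def)
  then have "card K \<le> card {..<chromatic_number G}"
    by (rule card_inj_on_le[OF inj_on_clique[OF f K(2)]]) simp
  then show ?thesis using K by simp
qed

section \<open>Generalized split graphs are perfect\<close>

lemma clique_Un:
  assumes "clique K E" "clique L E" "\<And>u v. u \<in> K \<Longrightarrow> v \<in> L \<Longrightarrow> {u, v} \<in> E"
  shows "clique (K \<union> L) E"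
  unfolding clique_def
proof (intro ballI impI)
  fix u v assume uv: "u \<in> K \<union> L" "v \<in> K \<union> L" "u \<noteq> v"
  have "{v, u} \<in> E" if "u \<in> L" "v \<in> K" using assms(3) that by blast
  then have "{u, v} \<in> E" if "u \<in> L" "v \<in> K" using that by (simp add: insert_commute)
  then show "{u, v} \<in> E" using assms uv unfolding clique_def by blast
qed

text \<open>
  The map \<open>p\<close> sends a vertex outside the central clique \<open>A\<close> to a label of its clique. Describing the
  cliques by a labelling makes restriction to an induced subgraph trivial, since
  the same labelling works there.

  Let \<open>A\<close> be coloured injectively by \<open>g\<close>. A vertex \<open>v\<close> outside \<open>A\<close> may use the colours \<open>S v\<close> that do not occur
  on its neighbours in \<open>A\<close>. For a set \<open>J\<close> of vertices in one of the cliques, the colours that none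
  of them may use are the colours of their common neighbours \<open>N\<close> in \<open>A\<close>. Now \<open>N \<union> J\<close> is a clique, so
  at least \<open>\<omega> - card N \<ge> card J\<close> colours are available to \<open>J\<close>, which is Hall's condition.
\<close>

lemma chromatic_eq_clique_number_unipolar:
  assumes G: "graph G" and A: "A \<subseteq> verts G" "clique A (edges G)"
    and p: "\<And>u v. \<lbrakk>u \<in> verts G - A; v \<in> verts G - A; u \<noteq> v\<rbrakk> \<Longrightarrow> {u, v} \<in> edges G \<longleftrightarrow> p u = p v"
  shows "chromatic_number G = clique_number G"
proof (rule antisym)
  let ?w = "clique_number G" and ?E = "edges G"
  have finV: "finite (verts G)" using G by (simp add: graph_def)
  have finA: "finite A" using A finV finite_subset by blast
  obtain g where g: "g ` A \<subseteq> {..<?w}" "inj_on g A"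
    using card_le_inj[OF finA, of "{..<?w}"] card_clique_le_clique_number[OF G A] by auto
  define S where "S v = {..<?w} - g ` {a \<in> A. {a, v} \<in> ?E}" for v
  define C where "C q = {v \<in> verts G - A. p v = q}" for q
  have "\<exists>r. inj_on r (C q) \<and> (\<forall>v\<in>C q. r v \<in> S v)" for q
  proof (rule hall_marriage)
    show "finite (C q)" using finV by (simp add: C_def)
    show "finite (S v)" for v by (simp add: S_def)
    show "card J \<le> card (\<Union>v\<in>J. S v)" if J: "J \<subseteq> C q" for J
    proof (cases "J = {}")
      case False
      define N where "N = {a \<in> A. \<forall>v\<in>J. {a, v} \<in> ?E}"
      have NA: "N \<subseteq> A" by (auto simp: N_def)
      have JV: "J \<subseteq> verts G - A" using J by (auto simp: C_def)
      have finN: "finite N" "finite J" using NA JV finA finV finite_subset by blast+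
      have "clique (N \<union> J) ?E"
      proof (rule clique_Un)
        show "clique N ?E" using A NA by (auto simp: clique_def)
        show "clique J ?E" unfolding clique_def using p J by (auto simp: C_def)
      qed (auto simp: N_def)
      moreover have "N \<union> J \<subseteq> verts G" using NA JV A(1) by blast
      ultimately have "card (N \<union> J) \<le> ?w"
        using card_clique_le_clique_number[OF G] by blast
      moreover have "card (N \<union> J) = card N + card J"
        using NA JV finN by (intro card_Un_disjoint) auto
      moreover have "card ({..<?w} - g ` N) = ?w - card N"
      proof -
        have "card (g ` N) = card N" using g NA by (metis card_image inj_on_subset)
        moreover have "g ` N \<subseteq> {..<?w}" using g NA by auto
        ultimately show ?thesis using finN by (simp add: card_Diff_subset)
      qed
      moreover have "{..<?w} - g ` N \<subseteq> (\<Union>v\<in>J. S v)"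
      proof
        fix c assume c: "c \<in> {..<?w} - g ` N"
        show "c \<in> (\<Union>v\<in>J. S v)"
        proof (cases "c \<in> g ` A")
          case True
          then obtain a where a: "a \<in> A" "c = g a" by blast
          then obtain v where v: "v \<in> J" "{a, v} \<notin> ?E" using c by (auto simp: N_def)
          have "c \<notin> g ` {a \<in> A. {a, v} \<in> ?E}"
            using a v g(2) by (auto simp: inj_on_def)
          then show ?thesis using c v by (auto simp: S_def)
        next
          case False
          then show ?thesis using c \<open>J \<noteq> {}\<close> by (auto simp: S_def)
        qed
      qed
      then have "card ({..<?w} - g ` N) \<le> card (\<Union>v\<in>J. S v)"
        using finN by (intro card_mono) (auto simp: S_def)
      ultimately show ?thesis by simp
    qed simp
  qed
  then obtain r where r: "\<And>q. inj_on (r q) (C q)" "\<And>q v. v \<in> C q \<Longrightarrow> r q v \<in> S v"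
    by metis
  define f where "f v = (if v \<in> A then g v else r (p v) v)" for v
  have rS: "r (p v) v \<in> S v" if "v \<in> verts G - A" for v
    using r(2)[of v "p v"] that by (simp add: C_def)
  have avoid: "g a \<noteq> r (p v) v" if "a \<in> A" "v \<in> verts G - A" "{a, v} \<in> ?E" for a v
  proof -
    have "g a \<in> g ` {a \<in> A. {a, v} \<in> ?E}" using that by blast
    then show ?thesis using rS[OF that(2)] by (auto simp only: S_def Diff_iff)
  qed
  have "f u \<noteq> f v" if uv: "{u, v} \<in> ?E" for u v
  proof -
    note e = graph_edge[OF G uv]
    have vu: "{v, u} \<in> ?E" using uv by (simp add: insert_commute)
    consider "u \<in> A" "v \<in> A" | "u \<in> A" "v \<notin> A" | "u \<notin> A" "v \<in> A" | "u \<notin> A" "v \<notin> A" by blast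
    then show ?thesis
    proof cases
      case 1 then show ?thesis using g e by (auto simp: f_def inj_on_def)
    next
      case 2 then show ?thesis using avoid[of u v] e uv by (simp add: f_def)
    next
      case 3 then show ?thesis using avoid[of v u] e vu by (simp add: f_def)
    next
      case 4
      then have "p u = p v" using p[of u v] e uv by simp
      then show ?thesis using r(1)[of "p u"] e 4 by (auto simp: f_def inj_on_def C_def)
    qed
  qed
  moreover have "f v < ?w" if "v \<in> verts G" for v
    using that g rS[of v] by (auto simp: f_def S_def)
  ultimately have "proper_colouring G f ?w" by (auto simp: proper_colouring_def)
  then show "chromatic_number G \<le> ?w" by (rule chromatic_number_le)
qed (rule clique_number_le_chromatic_number[OF G])

text \<open>
  In the complement of a unipolar graph, \<open>A\<close> is independent and the remaining vertices form a complete
  multipartite graph, whose parts are the fibres of \<open>p\<close>. A transversal of the \<open>m\<close> parts is a clique, and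
  the parts need \<open>m\<close> colours. Whether the vertices of \<open>A\<close> need one more depends on whether some
  \<open>a \<in> A\<close> has neighbours in all parts. If so, \<open>a\<close> extends a transversal to a clique of size \<open>m + 1\<close>; if
  not, every \<open>a \<in> A\<close> can take the colour of a part in which it has no neighbour.
\<close>

lemma chromatic_eq_clique_number_co_unipolar:
  assumes G: "graph G" and A: "A \<subseteq> verts G" "indep A (edges G)"
    and p: "\<And>u v. \<lbrakk>u \<in> verts G - A; v \<in> verts G - A; u \<noteq> v\<rbrakk> \<Longrightarrow> {u, v} \<in> edges G \<longleftrightarrow> p u \<noteq> p v"
  shows "chromatic_number G = clique_number G"
proof (rule antisym)
  let ?E = "edges G" and ?B = "verts G - A"
  let ?Q = "p ` ?B"
  have finV: "finite (verts G)" using G by (simp add: graph_def)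
  have finQ: "finite ?Q" using finV by simp
  have transversal: "t ` ?Q \<subseteq> ?B \<and> clique (t ` ?Q) ?E \<and> card (t ` ?Q) = card ?Q"
    if t: "\<And>q. q \<in> ?Q \<Longrightarrow> t q \<in> ?B \<and> p (t q) = q" for t
  proof (intro conjI)
    show "t ` ?Q \<subseteq> ?B" using t by blast
    show "clique (t ` ?Q) ?E"
      unfolding clique_def
    proof (intro ballI impI)
      fix u v assume u: "u \<in> t ` ?Q" and v: "v \<in> t ` ?Q" and ne: "u \<noteq> v"
      obtain q q' where "q \<in> ?Q" "u = t q" "q' \<in> ?Q" "v = t q'" using u v by blast
      then show "{u, v} \<in> ?E" using p[of u v] t ne by metis
    qed
    show "card (t ` ?Q) = card ?Q" by (intro card_image inj_onI) (metis t)
  qed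
  show "chromatic_number G \<le> clique_number G"
  proof (cases "\<exists>a\<in>A. \<forall>q\<in>?Q. \<exists>b\<in>?B. p b = q \<and> {a, b} \<in> ?E")
    case True
    then obtain a t where a: "a \<in> A"
      and t: "\<And>q. q \<in> ?Q \<Longrightarrow> t q \<in> ?B \<and> p (t q) = q \<and> {a, t q} \<in> ?E" by metis
    have K: "t ` ?Q \<subseteq> ?B" "clique (t ` ?Q) ?E" "card (t ` ?Q) = card ?Q"
      using transversal[of t] t by blast+
    have "clique ({a} \<union> t ` ?Q) ?E"
    proof (rule clique_Un)
      show "clique {a} ?E" by (simp add: clique_def)
      show "{u, v} \<in> ?E" if "u \<in> {a}" "v \<in> t ` ?Q" for u v using that t by blast
    qed (rule K)
    moreover have "card ({a} \<union> t ` ?Q) = Suc (card ?Q)"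
      using K a finQ by (subst K(3)[symmetric]) (simp, subst card_insert_disjoint, auto)
    ultimately have le: "Suc (card ?Q) \<le> clique_number G"
      using card_clique_le_clique_number[OF G, of "{a} \<union> t ` ?Q"] K(1) A a by auto
    \<comment> \<open>The extra colour \<open>None\<close> serves all of \<open>A\<close>.\<close>
    let ?f = "\<lambda>v. if v \<in> A then None else Some (p v)"
    have "chromatic_number G \<le> card (insert None (Some ` ?Q))"
    proof (rule chromatic_number_le_card[OF _ _ G])
      show "finite (insert None (Some ` ?Q))" using finQ by simp
      show "?f v \<in> insert None (Some ` ?Q)" if "v \<in> verts G" for v using that by auto
      show "?f u \<noteq> ?f v" if uv: "{u, v} \<in> ?E" for u v
        using graph_edge[OF G uv] A(2) p[of u v] uv by (auto simp: indep_def)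
    qed
    also have "\<dots> = Suc (card ?Q)" using finQ by (simp add: card_image)
    finally show ?thesis using le by simp
  next
    case False
    then obtain s where s: "\<And>a. a \<in> A \<Longrightarrow> s a \<in> ?Q"
      "\<And>a b. \<lbrakk>a \<in> A; b \<in> ?B; p b = s a\<rbrakk> \<Longrightarrow> {a, b} \<notin> ?E" by metis
    let ?f = "\<lambda>v. if v \<in> A then s v else p v"
    have "chromatic_number G \<le> card ?Q"
    proof (rule chromatic_number_le_card[OF finQ _ G])
      show "?f v \<in> ?Q" if "v \<in> verts G" for v using that s(1) by auto
      show "?f u \<noteq> ?f v" if uv: "{u, v} \<in> ?E" for u v
      proof -
        have vu: "{v, u} \<in> ?E" using uv by (simp add: insert_commute)
        show ?thesis
          using graph_edge[OF G uv] A(2) p[of u v] uv vu s(2)[of u v] s(2)[of v u]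
          by (auto simp: indep_def)
      qed
    qed
    also have "\<dots> \<le> clique_number G"
    proof -
      let ?t = "inv_into ?B p"
      have "?t ` ?Q \<subseteq> ?B \<and> clique (?t ` ?Q) ?E \<and> card (?t ` ?Q) = card ?Q"
        by (rule transversal) (simp only: inv_into_into f_inv_into_f simp_thms)
      then show ?thesis using card_clique_le_clique_number[OF G, of "?t ` ?Q"] by auto
    qed
    finally show ?thesis .
  qed
qed (rule clique_number_le_chromatic_number[OF G])

text \<open>
  A labelling passes to induced subgraphs more easily than a partition, whose members might become
  empty. A vertex is labelled by the member of the partition that contains it.
\<close>

lemma unipolar_partition_map:
  fixes G :: "'a sgraph"
  assumes "unipolar G"
  shows "\<exists>A (p :: 'a \<Rightarrow> 'a set). A \<subseteq> verts G \<and> clique A (edges G) \<and>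
    (\<forall>u\<in>verts G - A. \<forall>v\<in>verts G - A. u \<noteq> v \<longrightarrow> ({u, v} \<in> edges G \<longleftrightarrow> p u = p v))"
proof -
  obtain A B P where AB: "verts G = A \<union> B" "A \<inter> B = {}" "complete_graph (induced G A)"
    and P: "partition_on B P" "{e \<in> edges G. e \<subseteq> B} = (\<Union>C\<in>P. [C]\<^bsup>2\<^esup>)"
    using assms by (auto simp: unipolar_def disjoint_union_of_cliques_def induced_def)
  define p where "p v = (THE C. C \<in> P \<and> v \<in> C)" for v
  have p_eq: "p v = C" if "C \<in> P" "v \<in> C" for v C
  proof -
    have "D = C" if "D \<in> P" "v \<in> D" for D
      using that \<open>C \<in> P\<close> \<open>v \<in> C\<close> P(1) by (auto simp: partition_on_def disjoint_def)
    then show ?thesis unfolding p_def using that by (intro the_equality) blast+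
  qed
  have p_in: "p v \<in> P \<and> v \<in> p v" if "v \<in> B" for v
    using that p_eq P(1) by (auto simp: partition_on_def)
  have "{u, v} \<in> edges G \<longleftrightarrow> p u = p v" if uv: "u \<in> B" "v \<in> B" "u \<noteq> v" for u v
  proof -
    have "{u, v} \<in> edges G \<longleftrightarrow> (\<exists>C\<in>P. {u, v} \<in> [C]\<^bsup>2\<^esup>)"
      using P(2) uv by blast
    also have "\<dots> \<longleftrightarrow> (\<exists>C\<in>P. u \<in> C \<and> v \<in> C)" using uv by (simp add: nsets_def)
    also have "\<dots> \<longleftrightarrow> p u = p v" using p_eq p_in uv by metis
    finally show ?thesis .
  qed
  moreover have "verts G - A = B" using AB by blast
  moreover have "clique A (edges G)"
    using AB(3) by (auto simp: complete_graph_def induced_def clique_def)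
  ultimately show ?thesis using AB(1) by (intro exI[of _ A] exI[of _ p]) auto
qed

lemma edges_complement_iff:
  "\<lbrakk>u \<in> verts G; v \<in> verts G; u \<noteq> v\<rbrakk> \<Longrightarrow> {u, v} \<in> edges (complement G) \<longleftrightarrow> {u, v} \<notin> edges G"
  by (auto simp: complement_def nsets_def)

lemma perfect_unipolar:
  fixes G :: "'a sgraph"
  assumes G: "graph G" and "unipolar G"
  shows "perfect G"
  unfolding perfect_def
proof (intro allI impI)
  fix S assume S: "S \<subseteq> verts G"
  obtain A and p :: "'a \<Rightarrow> 'a set" where A: "A \<subseteq> verts G" "clique A (edges G)"
    and p: "\<forall>u\<in>verts G - A. \<forall>v\<in>verts G - A. u \<noteq> v \<longrightarrow> ({u, v} \<in> edges G \<longleftrightarrow> p u = p v)"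
    using unipolar_partition_map[OF assms(2)] by blast
  show "chromatic_number (induced G S) = clique_number (induced G S)"
  proof (rule chromatic_eq_clique_number_unipolar[OF graph_induced[OF G S], of "A \<inter> S" p])
    show "clique (A \<inter> S) (edges (induced G S))" using A(2) by (auto simp: clique_def induced_def)
  qed (use S p in \<open>auto simp: induced_def\<close>)
qed

lemma perfect_co_unipolar:
  fixes G :: "'a sgraph"
  assumes G: "graph G" and "co_unipolar G"
  shows "perfect G"
  unfolding perfect_def
proof (intro allI impI)
  fix S assume S: "S \<subseteq> verts G"
  have V: "verts (complement G) = verts G" by (simp add: complement_def)
  obtain A and p :: "'a \<Rightarrow> 'a set" where A: "A \<subseteq> verts G" "clique A (edges (complement G))"
    and p: "\<forall>u\<in>verts G - A. \<forall>v\<in>verts G - A. u \<noteq> v \<longrightarrow>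
      ({u, v} \<in> edges (complement G) \<longleftrightarrow> p u = p v)"
    using unipolar_partition_map[OF assms(2)[unfolded co_unipolar_def], unfolded V]
    by blast
  have indep: "indep A (edges G)"
    using A edges_complement_iff[of _ G] unfolding clique_def indep_def by (meson subsetD)
  have q: "{u, v} \<in> edges G \<longleftrightarrow> p u \<noteq> p v"
    if "u \<in> verts G - A" "v \<in> verts G - A" "u \<noteq> v" for u v
    using p edges_complement_iff[of u G v] that by auto
  show "chromatic_number (induced G S) = clique_number (induced G S)"
  proof (rule chromatic_eq_clique_number_co_unipolar[OF graph_induced[OF G S], of "A \<inter> S" p])
    show "indep (A \<inter> S) (edges (induced G S))" using indep by (auto simp: indep_def induced_def)
    show "{u, v} \<in> edges (induced G S) \<longleftrightarrow> p u \<noteq> p v"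
      if "u \<in> verts (induced G S) - A \<inter> S" "v \<in> verts (induced G S) - A \<inter> S" "u \<noteq> v" for u v
      using q[of u v] that S by (auto simp: induced_def)
  qed (auto simp: induced_def)
qed

text \<open>
  In the complement both sides are cliques, and one clique is a disjoint union of cliques.
\<close>

lemma co_unipolar_bipartite:
  assumes "bipartite G"
  shows "co_unipolar G"
proof -
  obtain X Y where XY: "verts G = X \<union> Y" "X \<inter> Y = {}" "indep X (edges G)" "indep Y (edges G)"
    using assms by (auto simp: bipartite_def)
  have V: "verts (complement G) = X \<union> Y" using XY by (simp add: complement_def)
  have E: "{u, v} \<in> edges (complement G) \<longleftrightarrow> {u, v} \<notin> edges G"
    if "u \<in> X \<union> Y" "v \<in> X \<union> Y" "u \<noteq> v" for u v
    using edges_complement_iff[of u G v] that XY by simp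
  have "complete_graph (induced (complement G) X)"
    using XY E by (auto simp: complete_graph_def induced_def clique_def indep_def)
  moreover have "disjoint_union_of_cliques (induced (complement G) Y)"
    unfolding disjoint_union_of_cliques_def
  proof (intro exI conjI)
    \<comment> \<open>A partition has no empty member, so \<open>Y = {}\<close> calls for the empty partition.\<close>
    show "partition_on (verts (induced (complement G) Y)) ({Y} - {{}})"
      by (auto simp: partition_on_def induced_def disjoint_def)
    have "edges (induced (complement G) Y) = [Y]\<^bsup>2\<^esup>"
      using XY by (auto simp: induced_def complement_def nsets_def indep_def card_2_iff)
    also have "\<dots> = (\<Union>C\<in>{Y} - {{}}. [C]\<^bsup>2\<^esup>)" by (cases "Y = {}") (auto simp: nsets_def)
    finally show "edges (induced (complement G) Y) = (\<Union>C\<in>{Y} - {{}}. [C]\<^bsup>2\<^esup>)" .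
  qed
  ultimately show ?thesis
    unfolding co_unipolar_def unipolar_def using V XY(2) by blast
qed

section \<open>Inclusions between the classes and their cover numbers\<close>

lemma BIP_subset_coUNIP: "BIP \<subseteq> coUNIP"
  using co_unipolar_bipartite by (auto simp: BIP_def coUNIP_def)

lemma coUNIP_subset_GSP: "coUNIP \<subseteq> GSP"
  by (auto simp: coUNIP_def GSP_def)

lemma GSP_subset_PERF: "GSP \<subseteq> PERF"
  using perfect_unipolar perfect_co_unipolar by (auto simp: GSP_def PERF_def)

lemma induced_verts:
  fixes G :: "'a sgraph"
  assumes "graph G"
  shows "induced G (verts G) = G"
proof -
  have "{e \<in> edges G. e \<subseteq> verts G} = edges G" using assms by (auto simp: graph_def nsets_def)
  then show ?thesis by (simp add: induced_def)
qed

lemma PERF_subset_CHI_EQ_OMEGA: "PERF \<subseteq> CHI_EQ_OMEGA"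
proof
  fix G :: "'a sgraph"
  assume "G \<in> PERF"
  then show "G \<in> CHI_EQ_OMEGA"
    using induced_verts[of G] by (auto simp: PERF_def CHI_EQ_OMEGA_def perfect_def)
qed

text \<open>
  The existence of some covering by the smaller class matters: without it the least number
  of covering graphs would be an unspecified value.
\<close>

lemma cover_number_antimono:
  assumes "Q \<subseteq> P" "covering Q G Gs"
  shows "cover_number P G \<le> cover_number Q G"
proof -
  have "\<exists>Gs. length Gs = cover_number Q G \<and> covering Q G Gs"
    unfolding cover_number_def by (rule LeastI_ex) (use assms(2) in blast)
  then have "\<exists>Gs. length Gs = cover_number Q G \<and> covering P G Gs"
    using assms(1) by (auto simp: covering_def)
  then show ?thesis unfolding cover_number_def[of P] by (rule Least_le)
qed

section \<open>Coverings as colourings by words\<close>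

lemma recolour:
  assumes G: "graph G" and f: "proper_colouring G f n"
    and g: "inj_on g {..<n}" "g ` {..<n} \<subseteq> W"
  shows "\<And>v. v \<in> verts G \<Longrightarrow> g (f v) \<in> W"
    and "\<And>u v. {u, v} \<in> edges G \<Longrightarrow> g (f u) \<noteq> g (f v)"
proof -
  have range: "f v \<in> {..<n}" if "v \<in> verts G" for v
    using f that by (auto simp: proper_colouring_def)
  show "g (f v) \<in> W" if "v \<in> verts G" for v using range[OF that] g(2) by blast
  show "g (f u) \<noteq> g (f v)" if uv: "{u, v} \<in> edges G" for u v
  proof -
    have "f u \<noteq> f v" using f uv by (simp add: proper_colouring_def)
    then show ?thesis
      using inj_on_eq_iff[OF g(1) range range] graph_edge(1,2)[OF G uv] by blast
  qed
qed

lemma inj_on_extension: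
  assumes "finite W" "finite X" "D \<subseteq> X" "inj_on e D" "e ` D \<subseteq> W" "card X \<le> card W"
  shows "\<exists>g. inj_on g X \<and> g ` X \<subseteq> W \<and> (\<forall>x\<in>D. g x = e x)"
proof -
  have "card (X - D) = card X - card D"
    using assms by (meson card_Diff_subset finite_subset)
  moreover have "card (W - e ` D) = card W - card D"
    using assms by (metis card_Diff_subset card_image finite_subset)
  ultimately have "card (X - D) \<le> card (W - e ` D)"
    using assms(6) by simp
  then obtain d where d: "d ` (X - D) \<subseteq> W - e ` D" "inj_on d (X - D)"
    using card_le_inj[of "X - D" "W - e ` D"] assms(1,2) by auto
  let ?g = "\<lambda>x. if x \<in> D then e x else d x"
  have "inj_on ?g (D \<union> (X - D))"
    using d assms(4) by (intro inj_on_disjoint_Un) auto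
  then have "inj_on ?g X" using assms(3) by (simp add: Un_absorb1)
  moreover have "?g ` X \<subseteq> W" using d assms(5) by auto
  ultimately show ?thesis by (intro exI[of _ ?g]) simp
qed

text \<open>
  Injectivity of the \<open>i\<close>-th letter on an edge \<open>{u, v}\<close> says that the words of \<open>u\<close> and \<open>v\<close> differ there.
\<close>

definition slice :: "'a sgraph \<Rightarrow> ('a \<Rightarrow> nat list) \<Rightarrow> nat \<Rightarrow> 'a sgraph" where
  "slice G h i = \<lparr>verts = verts G, edges = {e \<in> edges G. inj_on (\<lambda>v. h v ! i) e}\<rparr>"

lemma graph_slice: "graph G \<Longrightarrow> graph (slice G h i)"
  by (auto simp: graph_def slice_def)

definition words :: "nat \<Rightarrow> nat \<Rightarrow> nat list set" where
  "words b k = {w. set w \<subseteq> {..<b} \<and> length w = k}"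

lemma finite_words: "finite (words b k)" and card_words: "card (words b k) = b ^ k"
  unfolding words_def
  by (simp_all add: finite_lists_length_eq card_lists_length_eq)

lemma proper_colouring_slice:
  assumes "graph G" "\<And>v. v \<in> verts G \<Longrightarrow> h v \<in> words b k" "i < k"
  shows "proper_colouring (slice G h i) (\<lambda>v. h v ! i) b"
proof -
  have "h v ! i < b" if "v \<in> verts G" for v
  proof -
    have w: "set (h v) \<subseteq> {..<b}" "length (h v) = k" using assms(2)[OF that] by (auto simp: words_def)
    then have "h v ! i \<in> set (h v)" using assms(3) by simp
    then show ?thesis using w(1) by blast
  qed
  moreover have "h u ! i \<noteq> h v ! i" if "{u, v} \<in> edges (slice G h i)" for u v
    using that graph_edge(3)[OF graph_slice[OF assms(1)] that] by (auto simp: slice_def)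
  ultimately show ?thesis by (auto simp: proper_colouring_def slice_def)
qed

lemma edges_eq_Union_slices:
  assumes "graph G" "\<And>v. v \<in> verts G \<Longrightarrow> h v \<in> words b k"
    and "\<And>u v. {u, v} \<in> edges G \<Longrightarrow> h u \<noteq> h v"
  shows "edges G = (\<Union>H\<in>set (map (slice G h) [0..<k]). edges H)"
proof -
  have "\<exists>i<k. e \<in> edges (slice G h i)" if e: "e \<in> edges G" for e
  proof -
    obtain u v where uv: "e = {u, v}" "u \<in> verts G" "v \<in> verts G" "u \<noteq> v"
      using graph_edgeE[OF assms(1) e] .
    then have "length (h u) = k" "length (h v) = k" using assms(2) by (auto simp: words_def)
    moreover have "h u \<noteq> h v" using assms(3) e uv by blast
    ultimately obtain i where "i < k" "h u ! i \<noteq> h v ! i" using nth_equalityI by metis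
    then show ?thesis using e uv by (auto simp: slice_def inj_on_def)
  qed
  then have "edges G \<subseteq> (\<Union>H\<in>set (map (slice G h) [0..<k]). edges H)" by fastforce
  moreover have "edges (slice G h i) \<subseteq> edges G" for i by (auto simp: slice_def)
  ultimately show ?thesis by auto
qed

text \<open>
  The lower bound: the tuple of the colours in the covering graphs separates the ends of every edge.
\<close>

lemma chromatic_number_le_power:
  assumes "graph G" "edges G \<subseteq> (\<Union>H\<in>set Gs. edges H)" "0 < b"
    and Gs: "\<And>H. H \<in> set Gs \<Longrightarrow> graph H \<and> chromatic_number H \<le> b"
  shows "chromatic_number G \<le> b ^ length Gs"
proof -
  \<comment> \<open>The graphs \<open>H\<close> need not contain all vertices of \<open>G\<close>, so each colouring is extended by colour 0.\<close>
  have "\<exists>f. (\<forall>v. f v < b) \<and> (\<forall>u v. {u, v} \<in> edges H \<longrightarrow> f u \<noteq> f v)" if "H \<in> set Gs" for H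
  proof -
    have H: "graph H" "chromatic_number H \<le> b" using Gs that by auto
    obtain f where f: "proper_colouring H f (chromatic_number H)"
      using obtain_optimal_colouring[OF H(1)] .
    define g where "g v = (if v \<in> verts H then f v else 0)" for v
    have "g v < b" for v
    proof (cases "v \<in> verts H")
      case True
      then have "f v < chromatic_number H" using f by (auto simp: proper_colouring_def)
      then show ?thesis using True H(2) by (simp add: g_def)
    qed (use assms(3) in \<open>simp add: g_def\<close>)
    moreover have "g u \<noteq> g v" if "{u, v} \<in> edges H" for u v
      using f that graph_edge[OF H(1) that] by (simp add: g_def proper_colouring_def)
    ultimately show ?thesis by blast
  qed
  then obtain f where f: "\<And>H v. H \<in> set Gs \<Longrightarrow> f H v < b"
    "\<And>H u v. H \<in> set Gs \<Longrightarrow> {u, v} \<in> edges H \<Longrightarrow> f H u \<noteq> f H v" by metis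
  have "chromatic_number G \<le> card (words b (length Gs))"
  proof (rule chromatic_number_le_card[OF finite_words _ assms(1)])
    show "map (\<lambda>H. f H v) Gs \<in> words b (length Gs)" for v using f(1) by (auto simp: words_def)
    show "map (\<lambda>H. f H u) Gs \<noteq> map (\<lambda>H. f H v) Gs" if "{u, v} \<in> edges G" for u v
      using that assms(2) f(2) by fastforce
  qed
  then show ?thesis by (simp add: card_words)
qed

section \<open>Coverings by bipartite graphs\<close>

lemma bipartite_iff_chromatic_number_le_2:
  assumes "graph G"
  shows "bipartite G \<longleftrightarrow> chromatic_number G \<le> 2"
proof
  assume "bipartite G"
  then obtain X Y where XY: "verts G = X \<union> Y" "X \<inter> Y = {}" "indep X (edges G)" "indep Y (edges G)"
    by (auto simp: bipartite_def)
  have "chromatic_number G \<le> card (UNIV :: bool set)"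
  proof (rule chromatic_number_le_card[OF _ _ assms])
    show "(u \<in> X) \<noteq> (v \<in> X)" if "{u, v} \<in> edges G" for u v
      using graph_edge[OF assms that] that XY by (auto simp: indep_def)
  qed auto
  then show "chromatic_number G \<le> 2" by simp
next
  assume le: "chromatic_number G \<le> 2"
  obtain f where f: "proper_colouring G f (chromatic_number G)"
    using obtain_optimal_colouring[OF assms] .
  have f2: "f v < 2" if "v \<in> verts G" for v
  proof -
    have "f v < chromatic_number G" using f that by (auto simp: proper_colouring_def)
    then show ?thesis using le by simp
  qed
  show "bipartite G"
    unfolding bipartite_def
  proof (intro exI conjI)
    show "verts G = {v \<in> verts G. f v = 0} \<union> {v \<in> verts G. f v = 1}"
      using f2 by (auto simp: less_2_cases_iff)
    have "f u \<noteq> f v" if "{u, v} \<in> edges G" for u v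
      using f that by (simp add: proper_colouring_def)
    then show "indep {v \<in> verts G. f v = 0} (edges G)" "indep {v \<in> verts G. f v = 1} (edges G)"
      by (force simp: indep_def)+
  qed auto
qed

lemma bipartite_covering_iff:
  assumes G: "graph G"
  shows "(\<exists>Gs. length Gs = k \<and> covering BIP G Gs) \<longleftrightarrow> chromatic_number G \<le> 2 ^ k"
proof
  assume "\<exists>Gs. length Gs = k \<and> covering BIP G Gs"
  then obtain Gs where Gs: "length Gs = k" "set Gs \<subseteq> BIP" "edges G = (\<Union>H\<in>set Gs. edges H)"
    by (auto simp: covering_def)
  have "chromatic_number G \<le> 2 ^ length Gs"
  proof (rule chromatic_number_le_power[OF G])
    show "graph H \<and> chromatic_number H \<le> 2" if "H \<in> set Gs" for H
      using that Gs(2) bipartite_iff_chromatic_number_le_2[of H] by (auto simp: BIP_def)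
  qed (use Gs in auto)
  then show "chromatic_number G \<le> 2 ^ k" using Gs by simp
next
  assume le: "chromatic_number G \<le> 2 ^ k"
  obtain f where f: "proper_colouring G f (chromatic_number G)"
    using obtain_optimal_colouring[OF G] .
  \<comment> \<open>Any distinct words will do here, so the injection starts from the empty map.\<close>
  obtain g where g: "inj_on g {..<chromatic_number G}" "g ` {..<chromatic_number G} \<subseteq> words 2 k"
    using inj_on_extension[OF finite_words, of "{..<chromatic_number G}" "{}" undefined 2 k]
      le card_words[of 2 k] by auto
  let ?h = "\<lambda>v. g (f v)"
  have h: "\<And>v. v \<in> verts G \<Longrightarrow> ?h v \<in> words 2 k"
    and ne: "\<And>u v. {u, v} \<in> edges G \<Longrightarrow> ?h u \<noteq> ?h v"
    using recolour[OF G f g] by auto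
  let ?Gs = "map (slice G ?h) [0..<k]"
  have "slice G ?h i \<in> BIP" if "i < k" for i
    using chromatic_number_le[OF proper_colouring_slice[where h = ?h, OF G h that]] graph_slice[OF G]
      bipartite_iff_chromatic_number_le_2 by (auto simp: BIP_def)
  then have "covering BIP G ?Gs"
    using edges_eq_Union_slices[where h = ?h, OF G h ne] by (auto simp: covering_def)
  then show "\<exists>Gs. length Gs = k \<and> covering BIP G Gs" by (intro exI[of _ ?Gs]) simp
qed

section \<open>Coverings by graphs with equal chromatic and clique number\<close>

text \<open>
  Arbitrary distinct words for the colours would make the slices colourable with \<open>\<omega>(G)\<close> colours, but they
  might lack large cliques. Prescribing constant words on a maximum clique \<open>K\<close> repairs this: \<open>K\<close> stays a
  clique in every slice. The assumption \<open>2 \<le> \<omega>(G)\<close> excludes edgeless graphs, for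
  which \<open>\<omega>(G) ^ k\<close> does not grow with \<open>k\<close>.
\<close>

lemma chi_eq_omega_covering_iff:
  assumes G: "graph G" and w2: "2 \<le> clique_number G"
  shows "(\<exists>Gs. length Gs = k \<and> covering CHI_EQ_OMEGA G Gs) \<longleftrightarrow>
    chromatic_number G \<le> clique_number G ^ k"
proof
  let ?w = "clique_number G"
  assume "\<exists>Gs. length Gs = k \<and> covering CHI_EQ_OMEGA G Gs"
  then obtain Gs where Gs: "length Gs = k" "set Gs \<subseteq> CHI_EQ_OMEGA"
    "edges G = (\<Union>H\<in>set Gs. edges H)"
    by (auto simp: covering_def)
  have "chromatic_number G \<le> ?w ^ length Gs"
  proof (rule chromatic_number_le_power[OF G])
    fix H assume H: "H \<in> set Gs"
    then have gH: "graph H" and eq: "chromatic_number H = clique_number H"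
      using Gs(2) by (auto simp: CHI_EQ_OMEGA_def)
    obtain K where K: "K \<subseteq> verts H" "clique K (edges H)" "card K = clique_number H"
      using obtain_maximum_clique[OF gH] .
    \<comment> \<open>A vertex of \<open>H\<close> outside \<open>G\<close> is isolated, so it lies only in cliques with one vertex.\<close>
    have "card K \<le> ?w"
    proof (cases "card K < 2")
      case False
      have "v \<in> verts G" if "v \<in> K" for v
      proof -
        have "\<not> K \<subseteq> {v}" using False card_mono[of "{v}" K] by auto
        then obtain u where "u \<in> K" "u \<noteq> v" by blast
        then have "{u, v} \<in> edges G" using K(2) that Gs(3) H by (auto simp: clique_def)
        then show ?thesis using graph_edge[OF G] by blast
      qed
      moreover have "clique K (edges G)" using K(2) Gs(3) H by (auto simp: clique_def)
      ultimately show ?thesis using card_clique_le_clique_number[OF G] by blast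
    qed (use w2 in simp)
    then show "graph H \<and> chromatic_number H \<le> ?w" using gH eq K by simp
  qed (use Gs w2 in auto)
  then show "chromatic_number G \<le> ?w ^ k" using Gs by simp
next
  let ?w = "clique_number G" and ?x = "chromatic_number G"
  assume le: "?x \<le> ?w ^ k"
  \<comment> \<open>Constant words of different letters are different only if words are nonempty.\<close>
  have k: "0 < k"
    using le w2 clique_number_le_chromatic_number[OF G] by (cases k) auto
  obtain f where f: "proper_colouring G f ?x"
    using obtain_optimal_colouring[OF G] .
  obtain K where K: "K \<subseteq> verts G" "clique K (edges G)" "card K = ?w"
    using obtain_maximum_clique[OF G] .
  have injK: "inj_on f K" using inj_on_clique[OF f K(2)] .
  have finK: "finite K" using K(1) G finite_subset by (auto simp: graph_def)
  obtain d where d: "bij_betw d (f ` K) {..<?w}"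
    using ex_bij_betw_finite_nat[of "f ` K"] finK card_image[OF injK] K(3)
    by (auto simp: atLeast0LessThan)
  have "\<exists>g. inj_on g {..<?x} \<and> g ` {..<?x} \<subseteq> words ?w k \<and>
    (\<forall>c\<in>f ` K. g c = replicate k (d c))"
  proof (rule inj_on_extension[OF finite_words])
    show "f ` K \<subseteq> {..<?x}" using f K(1) by (auto simp: proper_colouring_def)
    show "inj_on (\<lambda>c. replicate k (d c)) (f ` K)"
      using d k by (auto simp: bij_betw_def inj_on_def)
    show "(\<lambda>c. replicate k (d c)) ` f ` K \<subseteq> words ?w k"
      using d by (auto simp: bij_betw_def words_def)
    show "card {..<?x} \<le> card (words ?w k)" using le by (simp add: card_words)
  qed simp
  then obtain g where g: "inj_on g {..<?x}" "g ` {..<?x} \<subseteq> words ?w k"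
    and gK: "\<forall>c\<in>f ` K. g c = replicate k (d c)"
    by blast
  let ?h = "\<lambda>v. g (f v)"
  have h: "\<And>v. v \<in> verts G \<Longrightarrow> ?h v \<in> words ?w k"
    and ne: "\<And>u v. {u, v} \<in> edges G \<Longrightarrow> ?h u \<noteq> ?h v"
    using recolour[OF G f g] by auto
  let ?Gs = "map (slice G ?h) [0..<k]"
  have "slice G ?h i \<in> CHI_EQ_OMEGA" if i: "i < k" for i
  proof -
    let ?H = "slice G ?h i"
    have H: "graph ?H" using graph_slice[OF G] .
    have "d (f u) \<noteq> d (f v)" if "u \<in> K" "v \<in> K" "u \<noteq> v" for u v
      using d injK that by (auto simp: bij_betw_def inj_on_def)
    then have "clique K (edges ?H)"
      using K(2) gK i by (auto simp: clique_def slice_def inj_on_def)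
    then have "?w \<le> clique_number ?H"
      using card_clique_le_clique_number[OF H, of K] K by (simp add: slice_def)
    moreover have "chromatic_number ?H \<le> ?w"
      using chromatic_number_le[OF proper_colouring_slice[where h = ?h, OF G h i]] by simp
    ultimately have "chromatic_number ?H = clique_number ?H"
      using clique_number_le_chromatic_number[OF H] by simp
    then show ?thesis using H by (simp add: CHI_EQ_OMEGA_def)
  qed
  then have "covering CHI_EQ_OMEGA G ?Gs"
    using edges_eq_Union_slices[where h = ?h, OF G h ne] by (auto simp: covering_def)
  then show "\<exists>Gs. length Gs = k \<and> covering CHI_EQ_OMEGA G Gs" by (intro exI[of _ ?Gs]) simp
qed

section \<open>Cover numbers as logarithms\<close>

text \<open>
  For \<open>n = 0\<close> both sides vanish because \<open>log b 0 = 0\<close>; this covers the graph without vertices.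
\<close>

lemma Least_power_eq_ceiling_log:
  fixes b n :: nat
  assumes "2 \<le> b"
  shows "int (LEAST k. n \<le> b ^ k) = \<lceil>log (real b) (real n)\<rceil>"
proof (cases "n = 0")
  case True
  then show ?thesis by (simp add: log_def)
next
  case False
  have le_iff: "n \<le> b ^ k \<longleftrightarrow> log b n \<le> real k" for k
  proof -
    have "n \<le> b ^ k \<longleftrightarrow> real n \<le> real b powr real k"
      using assms by (simp add: powr_realpow flip: of_nat_power)
    also have "\<dots> \<longleftrightarrow> log b n \<le> real k" using assms False by (simp add: log_le_iff)
    finally show ?thesis .
  qed
  have pos: "0 \<le> log b n" using assms False by simp
  have "(LEAST k. n \<le> b ^ k) = nat \<lceil>log b n\<rceil>"
    by (rule Least_equality) (auto simp: le_iff of_nat_ceiling nat_le_iff ceiling_le_iff)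
  then show ?thesis using pos by simp
qed

lemma edgeless_if_clique_number_less_2:
  assumes "graph G" "clique_number G < 2"
  shows "edges G = {}"
proof (rule ccontr)
  assume "edges G \<noteq> {}"
  then obtain e where e: "e \<in> edges G" by blast
  obtain u v where uv: "e = {u, v}" "u \<in> verts G" "v \<in> verts G" "u \<noteq> v"
    using graph_edgeE[OF assms(1) e] .
  then have "clique {u, v} (edges G)" using e by (auto simp: clique_def insert_commute)
  then show False using card_clique_le_clique_number[OF assms(1), of "{u, v}"] uv assms(2) by auto
qed

lemma cover_number_CHI_EQ_OMEGA:
  assumes G: "graph G"
  shows "int (cover_number CHI_EQ_OMEGA G) =
    \<lceil>log 2 (real (chromatic_number G)) / log 2 (real (clique_number G))\<rceil>"
proof (cases "2 \<le> clique_number G")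
  case True
  have "log 2 (real (chromatic_number G)) / log 2 (real (clique_number G)) =
    log (real (clique_number G)) (real (chromatic_number G))"
    using True by (simp add: log_def)
  then show ?thesis
    using Least_power_eq_ceiling_log[OF True]
    by (simp add: cover_number_def chi_eq_omega_covering_iff[OF G True])
next
  case False
  then have "covering CHI_EQ_OMEGA G []"
    using edgeless_if_clique_number_less_2[OF G] by (simp add: covering_def)
  then have "cover_number CHI_EQ_OMEGA G = 0"
    unfolding cover_number_def by (intro Least_eq_0) simp
  \<comment> \<open>Then \<open>log 2 \<omega> = 0\<close>, as \<open>log 2 0 = 0\<close>, and division by zero gives 0.\<close>
  moreover have "clique_number G = 0 \<or> clique_number G = 1" using False by auto
  ultimately show ?thesis by (auto simp: log_def)
qed

lemma cover_number_BIP: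
  assumes "graph G"
  shows "int (cover_number BIP G) = \<lceil>log 2 (real (chromatic_number G))\<rceil>"
  using Least_power_eq_ceiling_log[of 2 "chromatic_number G"]
  by (simp add: cover_number_def bipartite_covering_iff[OF assms])

theorem theorem6:
  fixes G :: "'a sgraph"
  assumes "graph G"
  shows "\<lceil>log 2 (real (chromatic_number G)) / log 2 (real (clique_number G))\<rceil>
           = int (cover_number CHI_EQ_OMEGA G)
       \<and> cover_number CHI_EQ_OMEGA G \<le> cover_number PERF G
       \<and> cover_number PERF G \<le> cover_number GSP G
       \<and> cover_number GSP G \<le> cover_number coUNIP G
       \<and> cover_number coUNIP G \<le> cover_number BIP G
       \<and> int (cover_number BIP G) = \<lceil>log 2 (real (chromatic_number G))\<rceil>"
proof -
  have "chromatic_number G \<le> 2 ^ chromatic_number G" by (simp add: less_imp_le)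
  then obtain Gs where BIP: "covering BIP G Gs"
    using bipartite_covering_iff[OF assms] by blast
  then have coUNIP: "covering coUNIP G Gs"
    using BIP_subset_coUNIP by (auto simp: covering_def)
  then have GSP: "covering GSP G Gs"
    using coUNIP_subset_GSP by (auto simp: covering_def)
  then have PERF: "covering PERF G Gs"
    using GSP_subset_PERF by (auto simp: covering_def)
  show ?thesis
    using cover_number_CHI_EQ_OMEGA[OF assms] cover_number_BIP[OF assms]
      cover_number_antimono[OF PERF_subset_CHI_EQ_OMEGA PERF]
      cover_number_antimono[OF GSP_subset_PERF GSP]
      cover_number_antimono[OF coUNIP_subset_GSP coUNIP]
      cover_number_antimono[OF BIP_subset_coUNIP BIP]
    by simp
qed

end
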